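(* Consider the Cox proportional hazards model with right censoring, with true regression parameter $\beta_0\in\mathbb{R}^d$ and i.i.d. observations $(T_i,\Delta_i,Z_i)$, $i=1,\dots,n$, distributed as $(T,\Delta,Z)$, as described in the context. Suppose that for all $q\ge 1$, $$\mathbb{E}\left[e^{q\beta_0'Z}\right]<\infty.$$ Let $p\ge 1$. Then there exists $K>0$ such that $$\sup_{n\ge 1}\mathbb{E}\left[n^{p/2}\sup_{t\in\mathbb{R}}|\Phi_n(t;\beta_0)-\Phi(t;\beta_0)|^p\right]\le K,$$ where $$\Phi_n(t;\beta)=\frac1n\sum_{i=1}^n\mathbf{1}_{\{T_i\ge t\}}e^{\beta'Z_i},\qquad \Phi(t;\beta)=\mathbb{E}\left[\mathbf{1}_{\{T\ge t\}}e^{\beta'Z}\right].$$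
   Context: Notation: $\beta'$ is the transpose of $\beta$ and $\mathbf{1}_A$ is the indicator of $A$. Model: $X\ge 0$ is the event time, $C\ge 0$ the censoring time, and $Z\in\mathbb{R}^d$ a covariate vector with distribution $F_Z$. Given $Z$, the variables $X$ and $C$ are independent. Conditionally on $Z=z$, $X$ has an absolutely continuous distribution function $F(x|z)$ with density $f(x|z)$, and $C$ has distribution function $G(x|z)$; the censoring mechanism is non-informative ($F$ and $G$ share no parameters). The hazard function of $X$ at time $t$ given $Z=z$ is $$\lambda(t|z)=\lambda_0(t)e^{\beta_0'z},\qquad t\in\mathbb{R}^+,$$ where $\lambda_0\geq 0$ is the baseline hazard and $\beta_0\in\mathbb{R}^d$ is the vector of regression coefficients. Put $T=\min(X,C)$ and $\Delta=\mathbf{1}_{\{X\le C\}}$. One observes $n$ i.i.d. copies $(T_i,\Delta_i,Z_i)$, $i=1,\dots,n$, of $(T,\Delta,Z)$. *)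

theory Defs
  imports "HOL-Probability.Probability"
begin

definition generated_algebra :: "'w measure \<Rightarrow> ('w \<Rightarrow> 'z::topological_space) \<Rightarrow> 'w measure" where
  "generated_algebra M Z = vimage_algebra (space M) Z borel"

text \<open>Conditional independence of \<open>X\<close> and \<open>C\<close> given \<open>Z\<close>:
  \<open>P(X \<in> A, C \<in> B | Z) = P(X \<in> A | Z) P(C \<in> B | Z)\<close> almost surely.\<close>

definition cond_indep_given ::
  "'w measure \<Rightarrow> ('w \<Rightarrow> 'z::topological_space) \<Rightarrow> ('w \<Rightarrow> real) \<Rightarrow> ('w \<Rightarrow> real) \<Rightarrow> bool" where
  "cond_indep_given M Z X C \<longleftrightarrow>
    (\<forall>A\<in>sets borel. \<forall>B\<in>sets borel. AE \<omega> in M.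
      real_cond_exp M (generated_algebra M Z) (indicator {\<omega>\<in>space M. X \<omega> \<in> A \<and> C \<omega> \<in> B}) \<omega>
      = real_cond_exp M (generated_algebra M Z) (indicator {\<omega>\<in>space M. X \<omega> \<in> A}) \<omega>
        * real_cond_exp M (generated_algebra M Z) (indicator {\<omega>\<in>space M. C \<omega> \<in> B}) \<omega>)"

text \<open>\<open>\<kappa>\<close> is a regular conditional distribution of \<open>Y\<close> given \<open>Z\<close>; the conditional
  distribution function of \<open>Y\<close> given \<open>Z = z\<close> is then \<open>cdf (\<kappa> z)\<close>.\<close>

definition cond_distribution ::
  "'w measure \<Rightarrow> ('w \<Rightarrow> 'z::topological_space) \<Rightarrow> ('w \<Rightarrow> real) \<Rightarrow> ('z \<Rightarrow> real measure) \<Rightarrow> bool" where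
  "cond_distribution M Z Y \<kappa> \<longleftrightarrow>
    \<kappa> \<in> measurable borel (prob_algebra borel) \<and>
    (\<forall>A\<in>sets borel. AE \<omega> in M.
      real_cond_exp M (generated_algebra M Z) (indicator {\<omega>\<in>space M. Y \<omega> \<in> A}) \<omega>
      = measure (\<kappa> (Z \<omega>)) A)"

definition hazard :: "real measure \<Rightarrow> (real \<Rightarrow> real) \<Rightarrow> real \<Rightarrow> real" where
  "hazard \<mu> f t = f t / (1 - cdf \<mu> t)"

definition follow_up_time :: "('w \<Rightarrow> real) \<Rightarrow> ('w \<Rightarrow> real) \<Rightarrow> 'w \<Rightarrow> real" where
  "follow_up_time X C \<omega> = min (X \<omega>) (C \<omega>)"

definition event_indicator :: "('w \<Rightarrow> real) \<Rightarrow> ('w \<Rightarrow> real) \<Rightarrow> 'w \<Rightarrow> real" where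
  "event_indicator X C \<omega> = of_bool (X \<omega> \<le> C \<omega>)"

text \<open>\<open>F z\<close> and \<open>G z\<close> are the conditional laws of \<open>X\<close> and \<open>C\<close> given \<open>Z = z\<close>, and
  \<open>f x z\<close> is the conditional density of \<open>X\<close>. The hazard is prescribed only at times with
  positive survival probability, since elsewhere the defining quotient is \<open>0 / 0\<close>.
  Non-informative censoring (\<open>G\<close> does not involve the parameters \<open>lambda\<^sub>0\<close>, \<open>\<beta>\<^sub>0\<close>) is a
  property of a parametrised family of laws; at one fixed true law, as here, it imposes
  no condition.\<close>

locale cox_model = prob_space M
  for M :: "'w measure" +
  fixes X C :: "'w \<Rightarrow> real"
    and Z :: "'w \<Rightarrow> real ^ 'd"
    and F G :: "real ^ 'd \<Rightarrow> real measure"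
    and f :: "real \<Rightarrow> real ^ 'd \<Rightarrow> real"
    and lambda\<^sub>0 :: "real \<Rightarrow> real"
    and \<beta>\<^sub>0 :: "real ^ 'd"
  assumes X_measurable: "random_variable borel X"
    and C_measurable: "random_variable borel C"
    and Z_measurable: "random_variable borel Z"
    and X_nonneg: "AE \<omega> in M. 0 \<le> X \<omega>"
    and C_nonneg: "AE \<omega> in M. 0 \<le> C \<omega>"
    and cond_indep: "cond_indep_given M Z X C"
    and cond_law_X: "cond_distribution M Z X F"
    and cond_law_C: "cond_distribution M Z C G"
    and density_measurable: "\<And>z. (\<lambda>x. f x z) \<in> borel_measurable borel"
    and density_nonneg: "\<And>x z. 0 \<le> f x z"
    and density_X: "\<And>z. F z = density lborel (\<lambda>x. ennreal (f x z))"
    and baseline_nonneg: "\<And>t. 0 \<le> t \<Longrightarrow> 0 \<le> lambda\<^sub>0 t"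
    and proportional_hazards:
      "\<And>t z. 0 \<le> t \<Longrightarrow> cdf (F z) t < 1 \<Longrightarrow>
        hazard (F z) (\<lambda>x. f x z) t = lambda\<^sub>0 t * exp (\<beta>\<^sub>0 \<bullet> z)"

text \<open>\<open>(Ti i, Di i, Zi i)\<close>, \<open>i = 1, 2, \<dots>\<close>, are i.i.d. copies of
  \<open>(min X C, 1{X \<le> C}, Z)\<close>; the sample of size \<open>n\<close> consists of those with \<open>1 \<le> i \<le> n\<close>.\<close>

locale cox_sample = cox_model M X C Z F G f lambda\<^sub>0 \<beta>\<^sub>0
  for M :: "'w measure"
    and X C :: "'w \<Rightarrow> real"
    and Z :: "'w \<Rightarrow> real ^ 'd"
    and F G :: "real ^ 'd \<Rightarrow> real measure"
    and f :: "real \<Rightarrow> real ^ 'd \<Rightarrow> real"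
    and lambda\<^sub>0 :: "real \<Rightarrow> real"
    and \<beta>\<^sub>0 :: "real ^ 'd" +
  fixes Ti :: "nat \<Rightarrow> 'w \<Rightarrow> real"
    and Di :: "nat \<Rightarrow> 'w \<Rightarrow> real"
    and Zi :: "nat \<Rightarrow> 'w \<Rightarrow> real ^ 'd"
  assumes independent:
      "indep_vars (\<lambda>_. borel \<Otimes>\<^sub>M borel \<Otimes>\<^sub>M borel) (\<lambda>i \<omega>. (Ti i \<omega>, Di i \<omega>, Zi i \<omega>)) {1..}"
    and identically_distributed:
      "\<And>i. 1 \<le> i \<Longrightarrow>
        distr M (borel \<Otimes>\<^sub>M borel \<Otimes>\<^sub>M borel) (\<lambda>\<omega>. (Ti i \<omega>, Di i \<omega>, Zi i \<omega>))
        = distr M (borel \<Otimes>\<^sub>M borel \<Otimes>\<^sub>M borel)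
            (\<lambda>\<omega>. (follow_up_time X C \<omega>, event_indicator X C \<omega>, Z \<omega>))"

definition Phi_emp ::
  "(nat \<Rightarrow> 'w \<Rightarrow> real) \<Rightarrow> (nat \<Rightarrow> 'w \<Rightarrow> real ^ 'd) \<Rightarrow> nat \<Rightarrow> real \<Rightarrow> real ^ 'd \<Rightarrow> 'w \<Rightarrow> real" where
  "Phi_emp Ti Zi n t \<beta> \<omega> = (1 / real n) * (\<Sum>i=1..n. of_bool (Ti i \<omega> \<ge> t) * exp (\<beta> \<bullet> Zi i \<omega>))"

definition Phi ::
  "'w measure \<Rightarrow> ('w \<Rightarrow> real) \<Rightarrow> ('w \<Rightarrow> real ^ 'd) \<Rightarrow> real \<Rightarrow> real ^ 'd \<Rightarrow> real" where
  "Phi M T Z t \<beta> = (\<integral>\<omega>. of_bool (T \<omega> \<ge> t) * exp (\<beta> \<bullet> Z \<omega>) \<partial>M)"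

text \<open>The random variable \<open>n\<^sup>p\<^sup>/\<^sup>2 sup\<^sub>t |\<Phi>\<^sub>n(t;\<beta>) - \<Phi>(t;\<beta>)|\<^sup>p\<close>, valued in \<open>[0,\<infinity>]\<close> so that no
  convention for unbounded suprema or non-integrable functions is involved.\<close>

definition scaled_sup_deviation ::
  "'w measure \<Rightarrow> ('w \<Rightarrow> real) \<Rightarrow> ('w \<Rightarrow> real ^ 'd) \<Rightarrow> (nat \<Rightarrow> 'w \<Rightarrow> real) \<Rightarrow> (nat \<Rightarrow> 'w \<Rightarrow> real ^ 'd)
    \<Rightarrow> real \<Rightarrow> real ^ 'd \<Rightarrow> nat \<Rightarrow> 'w \<Rightarrow> ennreal" where
  "scaled_sup_deviation M T Z Ti Zi p \<beta> n \<omega> =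
    ennreal (real n powr (p / 2)) *
    (SUP t. ennreal (\<bar>Phi_emp Ti Zi n t \<beta> \<omega> - Phi M T Z t \<beta>\<bar> powr p))"

end

theory Submission imports Defs begin

text \<open>
  The functions \<open>(x, z) \<mapsto> 1{x \<ge> t} * exp (\<beta> \<bullet> z)\<close> being averaged are tail indicators multiplied by a weight that
  does not depend on \<open>t\<close>. For such a one-parameter monotone family no entropy or chaining argument is
  needed to control the supremum over \<open>t\<close>: after symmetrisation the process is a random walk.

  It suffices to bound an even moment of order \<open>2 * m \<ge> p\<close> of the supremum over \<open>t\<close> of the centred sums
  by a constant multiple of \<open>n ^ m\<close> (\<open>weighted_tail_process_moment\<close>). A ghost sample replaces the
  centring (\<open>symmetrization_ghost_sample\<close>), and exchanging observations with their ghosts inserts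
  arbitrary signs (\<open>symmetrization_random_signs\<close>). Averaging over all signs with the data held
  fixed leaves \<open>sup\<^sub>t \<bar>\<Sum>\<^sub>i \<epsilon>\<^sub>i w\<^sub>i 1{\<tau>\<^sub>i \<ge> t}\<bar>\<close>: when the observations are sorted by \<open>\<tau>\<^sub>i\<close>, this
  is the maximal partial sum of independent symmetric terms. Levy's reflection principle
  (\<open>levy_maximal_inequality\<close>) reduces the maximum to the full sum, the exponential moments of signs give a
  bound by \<open>(\<Sum>\<^sub>i w\<^sub>i\<^sup>2) ^ m\<close>, and convexity bounds this by \<open>n ^ (m - 1) * \<Sum>\<^sub>i w\<^sub>i ^ (2 * m)\<close>
  (\<open>signed_tail_sum_maximal_moment\<close>), whose expectation is \<open>n ^ m\<close> times a moment of the weight. That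
  moment is finite by the exponential moment hypothesis on the covariates.
\<close>

section \<open>Maximal inequalities for randomly signed sums\<close>

text \<open>
  The set \<open>A\<close> of indices with positive sign encodes one realisation of independent fair
  signs, so averages over sign vectors become finite sums over \<open>Pow I\<close>.
\<close>

definition sign_of :: "'i set \<Rightarrow> 'i \<Rightarrow> real" where
  "sign_of A i = (if i \<in> A then 1 else - 1)"

lemma sum_Pow_insert:
  fixes g :: "'i set \<Rightarrow> real"
  assumes "finite J" "k \<notin> J"
  shows "(\<Sum>A\<in>Pow (insert k J). g A) = (\<Sum>A\<in>Pow J. g (insert k A)) + (\<Sum>A\<in>Pow J. g A)"
proof -
  have "inj_on (insert k) (Pow J)"
    using assms by (auto simp: inj_on_def)
  moreover have "Pow J \<inter> insert k ` Pow J = {}"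
    using assms by auto
  ultimately show ?thesis
    using assms by (simp add: Pow_insert sum.union_disjoint sum.reindex add.commute)
qed

text \<open>
  Levy's inequality. Lowering the threshold \<open>t\<close> adds the terms of \<open>{i. t \<le> \<tau> i}\<close> in the order of
  decreasing \<open>\<tau>\<close>, so the sums below are partial sums of a symmetric random walk started
  at \<open>x\<close>; the choice function \<open>\<theta>\<close> lets the threshold depend on the signs and thereby stands for
  the maximum over all of them. Equal values of \<open>\<tau>\<close> only remove some partial sums. Up to normalisation the claim reads
  \<open>E (max \<phi> - a)\<^sup>+ \<le> 2 * E (\<phi>(end) - a)\<^sup>+\<close>, and the level \<open>a\<close> makes the induction work:
  conditionally on the first step, the maximum over the whole path is the maximum of the remaining
  path with the level raised from \<open>a\<close> to \<open>b = max a (\<phi> x)\<close>. The excess \<open>b - a\<close> that this costs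
  is paid for by reflection: flipping all signs takes the endpoint \<open>x + S\<close> to \<open>x - S\<close>, and one of the
  two is at least as far from \<open>0\<close> as \<open>x\<close>.
\<close>

lemma levy_maximal_inequality:
  fixes \<phi> :: "real \<Rightarrow> real" and \<tau> w :: "'i \<Rightarrow> real"
  assumes \<phi>: "\<And>x y. \<bar>x\<bar> \<le> \<bar>y\<bar> \<Longrightarrow> \<phi> x \<le> \<phi> y" and "finite I"
  shows "(\<Sum>A\<in>Pow I. max a (\<phi> (x + (\<Sum>i\<in>I. sign_of A i * (of_bool (\<theta> A \<le> \<tau> i) * w i)))) + a)
    \<le> 2 * (\<Sum>A\<in>Pow I. max a (\<phi> (x + (\<Sum>i\<in>I. sign_of A i * w i))))"
  using \<open>finite I\<close>
proof (induction "card I" arbitrary: I x a \<theta>)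
  case 0
  then have "I = {}" by simp
  then show ?case by simp
next
  case (Suc n)
  \<comment> \<open>The walk makes the step with the largest \<open>\<tau>\<close> first: every nonempty tail set contains \<open>k\<close>.\<close>
  have "I \<noteq> {}" using Suc.hyps(2) by auto
  have "Max (\<tau> ` I) \<in> \<tau> ` I" using \<open>I \<noteq> {}\<close> \<open>finite I\<close> by simp
  then obtain k where k: "k \<in> I" and "\<tau> k = Max (\<tau> ` I)" by auto
  then have kmax: "\<tau> i \<le> \<tau> k" if "i \<in> I" for i
    using that \<open>finite I\<close> by simp
  define J where "J = I - {k}"
  have J: "finite J" "k \<notin> J" "I = insert k J" "n = card J"
    using Suc.hyps(2) \<open>finite I\<close> k by (auto simp: J_def)
  define b where "b = max a (\<phi> x)"
  define S where "S A = (\<Sum>i\<in>I. sign_of A i * w i)" for A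
  define R where "R A = (\<Sum>i\<in>I. sign_of A i * (of_bool (\<theta> A \<le> \<tau> i) * w i))" for A
  define L where "L A t = (\<Sum>i\<in>J. sign_of A i * (of_bool (t \<le> \<tau> i) * w i))" for A t
  define N where "N A = (\<Sum>i\<in>J. sign_of A i * w i)" for A
  have sgJ: "sign_of (insert k A) i = sign_of A i" if "i \<in> J" for i A
    using that J(2) by (auto simp: sign_of_def)
  have S_insert: "S (insert k A) = w k + N A" for A
    unfolding S_def N_def J(3) using J(1,2) sgJ by (simp add: sign_of_def[of _ k])
  have S_plain: "S A = - w k + N A" if "A \<subseteq> J" for A
  proof -
    have "k \<notin> A" using that J by auto
    then show ?thesis
      unfolding S_def N_def J(3) using J(1,2) by (simp add: sign_of_def[of _ k])
  qed
  have R_0: "R A = 0" if "\<not> \<theta> A \<le> \<tau> k" for A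
    unfolding R_def using that kmax by (force intro!: sum.neutral)
  have R_insert: "max a (\<phi> (x + R (insert k A))) \<le> max b (\<phi> (x + w k + L A (\<theta> (insert k A))))" for A
  proof (cases "\<theta> (insert k A) \<le> \<tau> k")
    case True
    then have "R (insert k A) = w k + L A (\<theta> (insert k A))"
      unfolding R_def L_def J(3) using J(1,2) sgJ by (simp add: sign_of_def[of _ k])
    then have "x + R (insert k A) = x + w k + L A (\<theta> (insert k A))" by simp
    then show ?thesis unfolding b_def
      by (simp only: le_max_iff_disj max.bounded_iff order_refl simp_thms, use linear in blast)
  next
    case False
    from R_0[OF this] show ?thesis by (simp add: b_def)
  qed
  have R_plain: "max a (\<phi> (x + R A)) \<le> max b (\<phi> (x - w k + L A (\<theta> A)))"
    if "A \<subseteq> J" for A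
  proof (cases "\<theta> A \<le> \<tau> k")
    case True
    have "k \<notin> A" using that J by auto
    with True have "R A = - w k + L A (\<theta> A)"
      unfolding R_def L_def J(3) using J(1,2) by (simp add: sign_of_def[of _ k])
    then have "x + R A = x - w k + L A (\<theta> A)" by simp
    then show ?thesis unfolding b_def
      by (simp only: le_max_iff_disj max.bounded_iff order_refl simp_thms, use linear in blast)
  next
    case False
    from R_0[OF this] show ?thesis by (simp add: b_def)
  qed
  have IH1: "(\<Sum>A\<in>Pow J. max b (\<phi> (x + w k + L A (\<theta> (insert k A)))) + b)
      \<le> 2 * (\<Sum>A\<in>Pow J. max b (\<phi> (x + w k + N A)))"
    using Suc.hyps(1)[OF J(4) J(1), of b "x + w k" "\<lambda>A. \<theta> (insert k A)"]
    by (simp add: L_def N_def)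
  have IH2: "(\<Sum>A\<in>Pow J. max b (\<phi> (x - w k + L A (\<theta> A))) + b)
      \<le> 2 * (\<Sum>A\<in>Pow J. max b (\<phi> (x - w k + N A)))"
    using Suc.hyps(1)[OF J(4) J(1), of b "x - w k" \<theta>]
    by (simp add: L_def N_def)
  have "(\<Sum>A\<in>Pow I. max a (\<phi> (x + R A)) + b)
      = (\<Sum>A\<in>Pow J. max a (\<phi> (x + R (insert k A))) + b) + (\<Sum>A\<in>Pow J. max a (\<phi> (x + R A)) + b)"
    unfolding J(3) by (rule sum_Pow_insert[OF J(1,2)])
  also have "\<dots> \<le> (\<Sum>A\<in>Pow J. max b (\<phi> (x + w k + L A (\<theta> (insert k A)))) + b)
      + (\<Sum>A\<in>Pow J. max b (\<phi> (x - w k + L A (\<theta> A))) + b)"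
    by (intro add_mono sum_mono R_insert R_plain order_refl) auto
  also have "\<dots> \<le> 2 * ((\<Sum>A\<in>Pow J. max b (\<phi> (x + w k + N A))) + (\<Sum>A\<in>Pow J. max b (\<phi> (x - w k + N A))))"
    using IH1 IH2 by simp
  also have "(\<Sum>A\<in>Pow J. max b (\<phi> (x + w k + N A))) + (\<Sum>A\<in>Pow J. max b (\<phi> (x - w k + N A)))
      = (\<Sum>A\<in>Pow J. max b (\<phi> (x + S (insert k A)))) + (\<Sum>A\<in>Pow J. max b (\<phi> (x + S A)))"
    by (intro arg_cong2[of _ _ _ _ "(+)"] sum.cong) (auto simp: S_insert S_plain algebra_simps)
  also have "\<dots> = (\<Sum>A\<in>Pow I. max b (\<phi> (x + S A)))"
    unfolding J(3) by (rule sum_Pow_insert[OF J(1,2), symmetric])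
  finally have main: "(\<Sum>A\<in>Pow I. max a (\<phi> (x + R A)) + b) \<le> 2 * (\<Sum>A\<in>Pow I. max b (\<phi> (x + S A)))" .

  \<comment> \<open>It remains to lower the level from \<open>b\<close> back to \<open>a\<close>; \<open>e\<close> is the cost, halved by reflection.\<close>
  define e where "e A = max b (\<phi> (x + S A)) - max a (\<phi> (x + S A))" for A
  have reflect: "S (I - A) = - S A" if "A \<subseteq> I" for A
    unfolding S_def sum_negf[symmetric] by (intro sum.cong) (auto simp: sign_of_def)
  have "(\<Sum>A\<in>Pow I. e (I - A)) = (\<Sum>A\<in>Pow I. e A)"
    by (rule sum.reindex_bij_witness[where i="\<lambda>A. I - A" and j="\<lambda>A. I - A"]) (auto simp: double_diff)
  then have "2 * (\<Sum>A\<in>Pow I. e A) = (\<Sum>A\<in>Pow I. e A + e (I - A))"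
    by (simp add: sum.distrib)
  also have "\<dots> \<le> (\<Sum>A\<in>Pow I. b - a)"
  proof (intro sum_mono)
    fix A assume "A \<in> Pow I"
    then have neg: "S (I - A) = - S A" using reflect by auto
    have "\<bar>x\<bar> \<le> \<bar>x + S A\<bar> \<or> \<bar>x\<bar> \<le> \<bar>x - S A\<bar>" by linarith
    then have "\<phi> x \<le> \<phi> (x + S A) \<or> \<phi> x \<le> \<phi> (x - S A)" using \<phi> by blast
    then show "e A + e (I - A) \<le> b - a"
      unfolding e_def neg b_def by (auto simp: max_def)
  qed
  finally have "(\<Sum>A\<in>Pow I. 2 * e A + a) \<le> (\<Sum>A\<in>Pow I. b)"
    by (simp add: sum.distrib sum_distrib_left algebra_simps)
  moreover have "(\<Sum>A\<in>Pow I. 2 * e A) = 2 * (\<Sum>A\<in>Pow I. max b (\<phi> (x + S A))) - 2 * (\<Sum>A\<in>Pow I. max a (\<phi> (x + S A)))"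
    by (simp add: e_def sum_subtractf right_diff_distrib sum_distrib_left)
  ultimately show ?case
    using main unfolding R_def S_def sum.distrib by linarith
qed

text \<open>
  The sharp bound is \<open>exp (x\<^sup>2 / 2)\<close>. Constants are irrelevant for the application, and without the
  factor \<open>1 / 2\<close> quadratic estimates of \<open>exp\<close> near \<open>0\<close> are enough.
\<close>

lemma cosh_le_exp_square: "cosh (x::real) \<le> exp (x\<^sup>2)"
proof (cases "\<bar>x\<bar> \<le> 1")
  case True
  define y where "y = \<bar>x\<bar>"
  have y: "0 \<le> y" "y \<le> 1" using True by (auto simp: y_def)
  have "exp (- y) \<le> 1 / (1 + y)"
    using exp_ge_add_one_self[of y] y by (simp add: exp_minus field_simps)
  also have "\<dots> \<le> 1 - y + y\<^sup>2"
  proof -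
    have "(1 - y + y\<^sup>2) * (1 + y) = 1 + y ^ 3" by (simp add: algebra_simps power2_eq_square power3_eq_cube)
    then have "1 \<le> (1 - y + y\<^sup>2) * (1 + y)" using y by simp
    then show ?thesis using y by (simp add: divide_le_eq)
  qed
  finally have "exp (- y) \<le> 1 - y + y\<^sup>2" .
  then have "cosh y \<le> 1 + y\<^sup>2"
    using exp_bound[OF y] by (simp add: cosh_field_def)
  also have "\<dots> \<le> exp (y\<^sup>2)" by (rule exp_ge_add_one_self)
  finally show ?thesis by (simp add: y_def)
next
  case False
  then have "\<bar>x\<bar> * 1 \<le> \<bar>x\<bar> * \<bar>x\<bar>" by (intro mult_left_mono) auto
  then have "\<bar>x\<bar> \<le> x\<^sup>2" by (simp add: power2_eq_square abs_mult_self_eq)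
  then have "exp x \<le> exp (x\<^sup>2)" "exp (- x) \<le> exp (x\<^sup>2)"
    by auto
  then have "exp x + exp (- x) \<le> exp (x\<^sup>2) * 2" by linarith
  then show ?thesis by (simp add: cosh_field_def)
qed

lemma power_le_fact_cosh: "x ^ q \<le> 2 * fact q * cosh (x::real)"
proof -
  have "\<bar>x\<bar> ^ q / fact q \<le> exp \<bar>x\<bar>"
  proof -
    have "(\<Sum>n\<in>{q}. \<bar>x\<bar> ^ n /\<^sub>R fact n) \<le> (\<Sum>n. \<bar>x\<bar> ^ n /\<^sub>R fact n)"
      by (intro sum_le_suminf summable_exp_generic) auto
    then show ?thesis by (simp add: exp_def field_simps)
  qed
  also have "\<dots> \<le> 2 * cosh \<bar>x\<bar>" by (simp add: cosh_field_def)
  finally have "\<bar>x\<bar> ^ q \<le> 2 * fact q * cosh x" by (simp add: field_simps)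
  moreover have "x ^ q \<le> \<bar>x\<bar> ^ q" by (metis abs_ge_self power_abs)
  ultimately show ?thesis by linarith
qed

lemma sum_exp_signed_sum:
  assumes "finite I"
  shows "(\<Sum>A\<in>Pow I. exp (\<Sum>i\<in>I. sign_of A i * w i)) = (\<Prod>i\<in>I. 2 * cosh (w i))"
proof -
  have "(\<Prod>i\<in>I. 2 * cosh (w i)) = (\<Prod>i\<in>I. exp (w i) + exp (- w i))"
    by (intro prod.cong) (simp_all add: cosh_field_def field_simps)
  also have "\<dots> = (\<Sum>A\<in>Pow I. (\<Prod>i\<in>A. exp (w i)) * (\<Prod>i\<in>I - A. exp (- w i)))"
    by (rule prod_add[OF assms])
  also have "\<dots> = (\<Sum>A\<in>Pow I. exp (\<Sum>i\<in>I. sign_of A i * w i))"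
  proof (intro sum.cong refl)
    fix A assume "A \<in> Pow I"
    then have "A \<subseteq> I" by simp
    have "(\<Sum>i\<in>I. sign_of A i * w i) = (\<Sum>i\<in>I - A. sign_of A i * w i) + (\<Sum>i\<in>A. sign_of A i * w i)"
      by (rule sum.subset_diff[OF \<open>A \<subseteq> I\<close> assms])
    also have "\<dots> = (\<Sum>i\<in>I - A. - w i) + (\<Sum>i\<in>A. w i)"
      by (intro arg_cong2[of _ _ _ _ "(+)"] sum.cong) (auto simp: sign_of_def)
    finally have "(\<Sum>i\<in>I. sign_of A i * w i) = (\<Sum>i\<in>A. w i) + (\<Sum>i\<in>I - A. - w i)"
      by simp
    then show "(\<Prod>i\<in>A. exp (w i)) * (\<Prod>i\<in>I - A. exp (- w i)) = exp (\<Sum>i\<in>I. sign_of A i * w i)"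
      using finite_subset[OF \<open>A \<subseteq> I\<close> assms] assms by (simp add: exp_add exp_sum del: sum_negf)
  qed
  finally show ?thesis ..
qed

lemma sum_cosh_signed_sum_le:
  assumes "finite I"
  shows "(\<Sum>A\<in>Pow I. cosh (\<Sum>i\<in>I. sign_of A i * w i)) \<le> 2 ^ card I * exp (\<Sum>i\<in>I. (w i)\<^sup>2)"
proof -
  have "(\<Sum>A\<in>Pow I. cosh (\<Sum>i\<in>I. sign_of A i * w i))
      = ((\<Sum>A\<in>Pow I. exp (\<Sum>i\<in>I. sign_of A i * w i)) + (\<Sum>A\<in>Pow I. exp (\<Sum>i\<in>I. sign_of A i * (- w i)))) / 2"
    by (simp add: cosh_field_def sum.distrib sum_divide_distrib[symmetric] sum_negf)
  also have "\<dots> = (\<Prod>i\<in>I. 2 * cosh (w i))"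
    unfolding sum_exp_signed_sum[OF assms] by simp
  also have "\<dots> \<le> (\<Prod>i\<in>I. 2 * exp ((w i)\<^sup>2))"
    by (intro prod_mono) (auto simp: cosh_le_exp_square)
  also have "\<dots> = 2 ^ card I * exp (\<Sum>i\<in>I. (w i)\<^sup>2)"
    using assms by (simp add: prod.distrib exp_sum)
  finally show ?thesis .
qed

text \<open>
  Khintchine's inequality for the maximum of the tail sums. The even moment is dominated by a
  hyperbolic cosine, to which Levy's inequality applies; for the full sum the cosine factorises into
  the individual signs and is at most \<open>exp V\<close>, where \<open>V\<close> is the sum of the squared weights. Scaling
  all weights by \<open>c = 1 / sqrt V\<close> first turns this into a constant. The number \<open>12\<close> collects
  the factor \<open>2\<close> from the cosine, the factor \<open>2\<close> from Levy's inequality and \<open>exp 1 \<le> 3\<close>.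
\<close>

lemma signed_tail_sum_moment_le_variance:
  fixes \<tau> w :: "'i \<Rightarrow> real"
  assumes "finite I"
  shows "(\<Sum>A\<in>Pow I. (\<Sum>i\<in>I. sign_of A i * (of_bool (\<theta> A \<le> \<tau> i) * w i)) ^ (2 * m))
    \<le> 12 * fact (2 * m) * 2 ^ card I * (\<Sum>i\<in>I. (w i)\<^sup>2) ^ m"
proof -
  define V where "V = (\<Sum>i\<in>I. (w i)\<^sup>2)"
  define R where "R A = (\<Sum>i\<in>I. sign_of A i * (of_bool (\<theta> A \<le> \<tau> i) * w i))" for A
  have "V \<ge> 0" unfolding V_def by (intro sum_nonneg) auto
  show ?thesis
  proof (cases "V = 0")
    case True
    then have w0: "w i = 0" if "i \<in> I" for i
      using that assms unfolding V_def by (subst (asm) sum_nonneg_eq_0_iff) auto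
    have "R A ^ (2 * m) \<le> 12 * fact (2 * m) * V ^ m" for A
      using w0 True by (cases m) (auto simp: R_def)
    then have "(\<Sum>A\<in>Pow I. R A ^ (2 * m)) \<le> (\<Sum>A\<in>Pow I. 12 * fact (2 * m) * V ^ m)"
      by (intro sum_mono)
    then show ?thesis using assms by (simp add: R_def V_def card_Pow mult_ac)
  next
    case False
    with \<open>V \<ge> 0\<close> have "V > 0" by simp
    define c where "c = 1 / sqrt V"
    have c2: "c\<^sup>2 = 1 / V" "c ^ (2 * m) = 1 / V ^ m" "c \<noteq> 0"
      using \<open>V > 0\<close> by (simp_all add: c_def power_divide power_mult)
    have mono: "cosh (c * x) \<le> cosh (c * y)" if "\<bar>x\<bar> \<le> \<bar>y\<bar>" for x y :: real
    proof -
      have "\<bar>c * x\<bar> \<le> \<bar>c * y\<bar>" unfolding abs_mult using that by (intro mult_left_mono) auto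
      then have "cosh \<bar>c * x\<bar> \<le> cosh \<bar>c * y\<bar>" by (subst cosh_real_nonneg_le_iff) auto
      then show ?thesis by (simp only: cosh_real_abs)
    qed
    have max0: "max 0 (cosh y) = cosh y" for y :: real
      using cosh_real_pos[of y] by linarith
    have "(\<Sum>A\<in>Pow I. R A ^ (2 * m)) = V ^ m * (\<Sum>A\<in>Pow I. (c * R A) ^ (2 * m))"
      using \<open>V > 0\<close> by (simp add: power_mult_distrib c2 sum_distrib_left)
    also have "\<dots> \<le> V ^ m * (\<Sum>A\<in>Pow I. 2 * fact (2 * m) * cosh (c * R A))"
      using \<open>V > 0\<close> by (intro mult_left_mono sum_mono power_le_fact_cosh) auto
    also have "(\<Sum>A\<in>Pow I. 2 * fact (2 * m) * cosh (c * R A)) = 2 * fact (2 * m) * (\<Sum>A\<in>Pow I. cosh (c * R A))"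
      by (simp add: sum_distrib_left)
    also have "(\<Sum>A\<in>Pow I. cosh (c * R A)) \<le> 2 * (\<Sum>A\<in>Pow I. cosh (c * (\<Sum>i\<in>I. sign_of A i * w i)))"
      using levy_maximal_inequality[of "\<lambda>x. cosh (c * x)" I 0 0 \<theta> \<tau> w, OF mono assms]
      by (simp add: max0 R_def)
    also have "(\<Sum>A\<in>Pow I. cosh (c * (\<Sum>i\<in>I. sign_of A i * w i))) = (\<Sum>A\<in>Pow I. cosh (\<Sum>i\<in>I. sign_of A i * (c * w i)))"
      by (simp add: sum_distrib_left mult_ac)
    also have "\<dots> \<le> 2 ^ card I * exp (\<Sum>i\<in>I. (c * w i)\<^sup>2)"
      by (rule sum_cosh_signed_sum_le[OF assms])
    also have "(\<Sum>i\<in>I. (c * w i)\<^sup>2) = 1"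
      using \<open>V > 0\<close> by (simp add: power_mult_distrib c2 sum_divide_distrib[symmetric] V_def)
    also have "V ^ m * (2 * fact (2 * m) * (2 * (2 ^ card I * exp 1)))
        \<le> V ^ m * (2 * fact (2 * m) * (2 * (2 ^ card I * (3::real))))"
      using exp_le \<open>V > 0\<close> by (intro mult_left_mono) auto
    finally show ?thesis
      using \<open>V > 0\<close> by (simp add: R_def V_def mult_ac)
  qed
qed

lemma sum_power_even_le:
  fixes a :: "'i \<Rightarrow> real"
  assumes "finite I" "even m" "m > 0"
  shows "(\<Sum>i\<in>I. a i) ^ m \<le> real (card I) ^ (m - 1) * (\<Sum>i\<in>I. a i ^ m)"
proof (cases "I = {}")
  case True
  then show ?thesis using assms by (simp add: power_0_left)
next
  case False
  define n where "n = real (card I)"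
  have "n > 0" using False assms by (simp add: n_def card_gt_0_iff)
  have "(\<Sum>i\<in>I. (1 / n) *\<^sub>R a i) ^ m \<le> (\<Sum>i\<in>I. 1 / n * a i ^ m)"
    using \<open>n > 0\<close> assms False
    by (intro convex_on_sum[OF _ _ convex_power_even]) (auto simp: n_def)
  then have "(\<Sum>i\<in>I. a i) ^ m / n ^ m \<le> (\<Sum>i\<in>I. a i ^ m) / n"
    by (simp add: sum_divide_distrib[symmetric] power_divide)
  then have "(\<Sum>i\<in>I. a i) ^ m \<le> (n ^ m / n) * (\<Sum>i\<in>I. a i ^ m)"
    using \<open>n > 0\<close> by (simp add: field_simps)
  also have "n ^ m / n = n ^ (m - 1)"
    using \<open>n > 0\<close> \<open>m > 0\<close> by (simp add: power_diff)
  finally show ?thesis by (simp add: n_def)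
qed

lemma SUP_attained_finite_range:
  fixes f :: "'t \<Rightarrow> 'b :: complete_linorder"
  assumes "finite (range f)"
  shows "\<exists>t. (SUP t. f t) = f t"
proof -
  have "Sup (range f) = Max (range f)" using assms by (intro Max_Sup[symmetric]) auto
  moreover have "Max (range f) \<in> range f" using assms by (intro Max_in) auto
  ultimately show ?thesis by auto
qed

text \<open>
  The same bound with a genuine supremum over the threshold. The power \<open>m - 1\<close> of the
  sample size is what yields the rate \<open>sqrt n\<close> after summing \<open>n\<close> moments. Evenness of \<open>m\<close> makes
  \<open>\<lambda>x. x ^ m\<close> convex on the whole line.
\<close>

lemma signed_tail_sum_maximal_moment:
  fixes \<tau> w :: "'i \<Rightarrow> real"
  assumes I: "finite I" and m: "even m" "m > 0"
  shows "(\<Sum>A\<in>Pow I. SUP t. ennreal ((\<Sum>i\<in>I. sign_of A i * (of_bool (t \<le> \<tau> i) * w i)) ^ (2 * m)))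
    \<le> ennreal (12 * fact (2 * m) * 2 ^ card I * real (card I) ^ (m - 1) * (\<Sum>i\<in>I. w i ^ (2 * m)))"
proof -
  let ?R = "\<lambda>A t. (\<Sum>i\<in>I. sign_of A i * (of_bool (t \<le> \<tau> i) * w i)) ^ (2 * m)"
  \<comment> \<open>The tail sets \<open>{i \<in> I. t \<le> \<tau> i}\<close> are finitely many, so a maximising threshold exists for each \<open>A\<close>.\<close>
  have "\<exists>t. (SUP t. ennreal (?R A t)) = ennreal (?R A t)" for A
  proof (rule SUP_attained_finite_range, rule finite_subset)
    show "range (\<lambda>t. ennreal (?R A t))
        \<subseteq> (\<lambda>B. ennreal ((\<Sum>i\<in>I. sign_of A i * (of_bool (i \<in> B) * w i)) ^ (2 * m))) ` Pow I"
    proof (rule image_subsetI)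
      fix t
      have "(\<Sum>i\<in>I. sign_of A i * (of_bool (t \<le> \<tau> i) * w i))
          = (\<Sum>i\<in>I. sign_of A i * (of_bool (i \<in> {i\<in>I. t \<le> \<tau> i}) * w i))"
        by (intro sum.cong) auto
      then show "ennreal (?R A t) \<in> (\<lambda>B. ennreal ((\<Sum>i\<in>I. sign_of A i * (of_bool (i \<in> B) * w i)) ^ (2 * m))) ` Pow I"
        by (intro image_eqI[of _ _ "{i\<in>I. t \<le> \<tau> i}"]) auto
    qed
  qed (use I in simp)
  then obtain \<theta> where \<theta>: "(SUP t. ennreal (?R A t)) = ennreal (?R A (\<theta> A))" for A
    using choice[of "\<lambda>A t. (SUP t. ennreal (?R A t)) = ennreal (?R A t)"] by blast
  have "(\<Sum>A\<in>Pow I. SUP t. ennreal (?R A t)) = ennreal (\<Sum>A\<in>Pow I. ?R A (\<theta> A))"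
    unfolding \<theta> by (intro sum_ennreal) auto
  also have "\<dots> \<le> ennreal (12 * fact (2 * m) * 2 ^ card I * (\<Sum>i\<in>I. (w i)\<^sup>2) ^ m)"
    by (intro ennreal_leI signed_tail_sum_moment_le_variance I)
  also have "\<dots> \<le> ennreal (12 * fact (2 * m) * 2 ^ card I * (real (card I) ^ (m - 1) * (\<Sum>i\<in>I. ((w i)\<^sup>2) ^ m)))"
    by (intro ennreal_leI mult_left_mono sum_power_even_le I m) auto
  finally show ?thesis by (simp only: power_mult[symmetric] mult.assoc)
qed

section \<open>Symmetrisation and the moment inequality\<close>

text \<open>
  For a nonnegative convex function the right-hand side may be infinite, which spares the proof of
  integrability wherever Jensen's inequality is applied below.
\<close>

lemma (in prob_space) jensen_nn_integral:
  fixes X :: "'a \<Rightarrow> real" and q :: "real \<Rightarrow> real"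
  assumes "integrable M X" "convex_on UNIV q" "\<And>x. 0 \<le> q x" "q \<in> borel_measurable borel"
  shows "ennreal (q (expectation X)) \<le> (\<integral>\<^sup>+ \<omega>. ennreal (q (X \<omega>)) \<partial>M)"
proof (cases "integrable M (\<lambda>\<omega>. q (X \<omega>))")
  case True
  have "q (expectation X) \<le> expectation (\<lambda>\<omega>. q (X \<omega>))"
    using assms(1,2) True by (intro jensens_inequality[of X UNIV 0 0 q]) auto
  then show ?thesis
    using True assms(3) by (subst nn_integral_eq_integral) (auto intro: ennreal_leI)
next
  case False
  have "X \<in> borel_measurable M" using assms(1) by (rule borel_measurable_integrable)
  then have "(\<lambda>\<omega>. q (X \<omega>)) \<in> borel_measurable M"
    by (rule measurable_compose[OF _ assms(4)])
  then have "\<not> (\<integral>\<^sup>+ \<omega>. ennreal (q (X \<omega>)) \<partial>M) < \<infinity>"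
    using False assms(3) integrableI_nonneg[of "\<lambda>\<omega>. q (X \<omega>)" M] by blast
  then show ?thesis by (simp add: less_top[symmetric])
qed

lemma borel_measurable_PiM_component:
  assumes "g \<in> borel_measurable Q" "i \<in> I"
  shows "(\<lambda>x. g (x i)) \<in> borel_measurable (Pi\<^sub>M I (\<lambda>_. Q))"
  using measurable_compose[OF measurable_component_singleton[of i I "\<lambda>_. Q"] assms(1)] assms(2) by simp

lemma integral_PiM_component:
  fixes g :: "'a \<Rightarrow> real"
  assumes Q: "prob_space Q" and i: "i \<in> I" and g: "integrable Q g"
  shows "integrable (Pi\<^sub>M I (\<lambda>_. Q)) (\<lambda>x. g (x i))"
    and "(\<integral>x. g (x i) \<partial>Pi\<^sub>M I (\<lambda>_. Q)) = (\<integral>y. g y \<partial>Q)"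
proof -
  have d: "distr (Pi\<^sub>M I (\<lambda>_. Q)) Q (\<lambda>x. x i) = Q"
    using distr_PiM_component[of I "\<lambda>_. Q" i] Q i by auto
  have m: "(\<lambda>x. x i) \<in> measurable (Pi\<^sub>M I (\<lambda>_. Q)) Q"
    using i by measurable
  show "integrable (Pi\<^sub>M I (\<lambda>_. Q)) (\<lambda>x. g (x i))"
    by (rule integrable_distr[OF m]) (simp add: d g)
  show "(\<integral>x. g (x i) \<partial>Pi\<^sub>M I (\<lambda>_. Q)) = (\<integral>y. g y \<partial>Q)"
    using integral_distr[OF m, of g] g by (simp add: d)
qed

text \<open>
  The coordinates \<open>n + 1, \<dots>, 2 * n\<close> form an independent ghost sample. Integrating over them only turns
  \<open>g t (z (i + n))\<close> into its mean, so Jensen's inequality moves the integral out of the power, and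
  then it can be moved out of the supremum.
\<close>

lemma symmetrization_ghost_sample:
  fixes g :: "'t \<Rightarrow> 'a \<Rightarrow> real" and n :: nat
  assumes Q: "prob_space Q" and T: "countable T" and g: "\<And>t. t \<in> T \<Longrightarrow> integrable Q (g t)"
    and q: "even q"
  shows "(\<integral>\<^sup>+ x. (SUP t\<in>T. ennreal ((\<Sum>i=1..n. g t (x i) - (\<integral>y. g t y \<partial>Q)) ^ q)) \<partial>Pi\<^sub>M {1..n} (\<lambda>_. Q))
    \<le> (\<integral>\<^sup>+ z. (SUP t\<in>T. ennreal ((\<Sum>i=1..n. g t (z i) - g t (z (i + n))) ^ q)) \<partial>Pi\<^sub>M {1..2 * n} (\<lambda>_. Q))"
proof -
  define J where "J = {n+1..2*n}"
  have IJ: "{1..n} \<inter> J = {}" "finite {1..n}" "finite J" "{1..n} \<union> J = {1..2 * n}"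
    by (auto simp: J_def)
  interpret Q: prob_space Q by (rule Q)
  interpret product_sigma_finite "\<lambda>_::nat. Q" by standard
  interpret PJ: prob_space "Pi\<^sub>M J (\<lambda>_. Q)" by (intro prob_space_PiM Q)
  define H where "H z = (SUP t\<in>T. ennreal ((\<Sum>i=1..n. g t (z i) - g t (z (i + n))) ^ q))" for z
  have gm[measurable]: "g t \<in> borel_measurable Q" if "t \<in> T" for t
    using g[OF that] by auto
  have H_meas: "H \<in> borel_measurable (Pi\<^sub>M ({1..n} \<union> J) (\<lambda>_. Q))"
    unfolding H_def IJ(4)
  proof (intro borel_measurable_SUP T measurable_compose[OF _ measurable_ennreal]
      borel_measurable_power borel_measurable_sum borel_measurable_diff)
    fix t i assume "t \<in> T" "i \<in> {1..n}"
    then show "(\<lambda>z. g t (z i)) \<in> borel_measurable (Pi\<^sub>M {1..2*n} (\<lambda>_. Q))"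
      "(\<lambda>z. g t (z (i + n))) \<in> borel_measurable (Pi\<^sub>M {1..2*n} (\<lambda>_. Q))"
      by (auto intro!: borel_measurable_PiM_component gm)
  qed
  have "(\<integral>\<^sup>+ x. (SUP t\<in>T. ennreal ((\<Sum>i=1..n. g t (x i) - (\<integral>y. g t y \<partial>Q)) ^ q)) \<partial>Pi\<^sub>M {1..n} (\<lambda>_. Q))
    \<le> (\<integral>\<^sup>+ x. (\<integral>\<^sup>+ y. H (merge {1..n} J (x, y)) \<partial>Pi\<^sub>M J (\<lambda>_. Q)) \<partial>Pi\<^sub>M {1..n} (\<lambda>_. Q))"
  proof (intro nn_integral_mono SUP_least)
    fix x t assume t: "t \<in> T"
    define D where "D y = (\<Sum>i=1..n. g t (x i) - g t (y (i + n)))" for y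
    have iJ: "i + n \<in> J" if "i \<in> {1..n}" for i using that by (auto simp: J_def)
    note intg = integral_PiM_component[OF Q iJ g[OF t]]
    have D: "integrable (Pi\<^sub>M J (\<lambda>_. Q)) D"
      unfolding D_def by (intro Bochner_Integration.integrable_sum Bochner_Integration.integrable_diff intg) auto
    have "(\<integral>y. D y \<partial>Pi\<^sub>M J (\<lambda>_. Q)) = (\<Sum>i=1..n. g t (x i) - (\<integral>y. g t y \<partial>Q))"
      unfolding D_def
      by (subst Bochner_Integration.integral_sum)
        (auto intro!: sum.cong Bochner_Integration.integrable_diff intg simp: intg PJ.prob_space)
    moreover have "ennreal ((\<integral>y. D y \<partial>Pi\<^sub>M J (\<lambda>_. Q)) ^ q) \<le> (\<integral>\<^sup>+ y. ennreal (D y ^ q) \<partial>Pi\<^sub>M J (\<lambda>_. Q))"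
      by (intro PJ.jensen_nn_integral D convex_power_even q) (auto intro: zero_le_even_power q)
    ultimately have "ennreal ((\<Sum>i=1..n. g t (x i) - (\<integral>y. g t y \<partial>Q)) ^ q)
      \<le> (\<integral>\<^sup>+ y. ennreal (D y ^ q) \<partial>Pi\<^sub>M J (\<lambda>_. Q))" by simp
    also have "\<dots> \<le> (\<integral>\<^sup>+ y. H (merge {1..n} J (x, y)) \<partial>Pi\<^sub>M J (\<lambda>_. Q))"
    proof (rule nn_integral_mono)
      fix y
      have "D y = (\<Sum>i=1..n. g t (merge {1..n} J (x, y) i) - g t (merge {1..n} J (x, y) (i + n)))"
        unfolding D_def by (intro sum.cong) (auto simp: merge_def J_def)
      then show "ennreal (D y ^ q) \<le> H (merge {1..n} J (x, y))"
        unfolding H_def using t by (intro SUP_upper2[of t]) auto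
    qed
    finally show "ennreal ((\<Sum>i=1..n. g t (x i) - (\<integral>y. g t y \<partial>Q)) ^ q)
      \<le> (\<integral>\<^sup>+ y. H (merge {1..n} J (x, y)) \<partial>Pi\<^sub>M J (\<lambda>_. Q))" .
  qed
  also have "\<dots> = (\<integral>\<^sup>+ z. H z \<partial>Pi\<^sub>M {1..2 * n} (\<lambda>_. Q))"
    by (rule product_nn_integral_fold[OF IJ(1-3) H_meas, unfolded IJ(4), symmetric])
  finally show ?thesis by (simp add: H_def)
qed

text \<open>
  Exchanging a coordinate with its ghost preserves the product law and changes the sign of their
  difference, so the signs can be chosen at will.
\<close>

lemma symmetrization_random_signs:
  fixes g :: "'t \<Rightarrow> 'a \<Rightarrow> real" and n :: nat
  assumes Q: "prob_space Q" and T: "countable T" and gm: "\<And>t. t \<in> T \<Longrightarrow> g t \<in> borel_measurable Q"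
    and A: "A \<subseteq> {1..n}"
  shows "(\<integral>\<^sup>+ z. (SUP t\<in>T. ennreal ((\<Sum>i=1..n. sign_of A i * (g t (z i) - g t (z (i + n)))) ^ q)) \<partial>Pi\<^sub>M {1..2 * n} (\<lambda>_. Q))
    = (\<integral>\<^sup>+ z. (SUP t\<in>T. ennreal ((\<Sum>i=1..n. g t (z i) - g t (z (i + n))) ^ q)) \<partial>Pi\<^sub>M {1..2 * n} (\<lambda>_. Q))"
proof -
  define H where "H z = (SUP t\<in>T. ennreal ((\<Sum>i=1..n. g t (z i) - g t (z (i + n))) ^ q))" for z
  have H_meas: "H \<in> borel_measurable (Pi\<^sub>M {1..2 * n} (\<lambda>_. Q))"
    unfolding H_def
  proof (intro borel_measurable_SUP T measurable_compose[OF _ measurable_ennreal]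
      borel_measurable_power borel_measurable_sum borel_measurable_diff)
    fix t i assume "t \<in> T" "i \<in> {1..n}"
    then show "(\<lambda>z. g t (z i)) \<in> borel_measurable (Pi\<^sub>M {1..2*n} (\<lambda>_. Q))"
      "(\<lambda>z. g t (z (i + n))) \<in> borel_measurable (Pi\<^sub>M {1..2*n} (\<lambda>_. Q))"
      by (auto intro!: borel_measurable_PiM_component gm)
  qed
  \<comment> \<open>The permutation exchanging \<open>i\<close> and \<open>i + n\<close> for exactly those \<open>i \<le> n\<close> that are not in \<open>A\<close>.\<close>
  define \<sigma> where "\<sigma> k = (if k \<le> n then (if k \<in> A then k else k + n) else (if k - n \<in> A then k else k - n))" for k
  have \<sigma>_mem: "\<sigma> k \<in> {1..2 * n}" if "k \<in> {1..2 * n}" for k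
    using that by (auto simp: \<sigma>_def)
  have \<sigma>_inv: "\<sigma> (\<sigma> k) = k" if k: "k \<in> {1..2 * n}" for k
  proof (cases "k \<le> n")
    case True
    with k show ?thesis by (cases "k \<in> A") (simp_all add: \<sigma>_def)
  next
    case False
    define j where "j = k - n"
    have j: "k = j + n" "j \<noteq> 0" "j \<le> n" using False k by (simp_all add: j_def)
    show ?thesis using j(2,3) unfolding j(1) by (cases "j \<in> A") (simp_all add: \<sigma>_def)
  qed
  have \<sigma>: "inj_on \<sigma> {1..2 * n}" "\<sigma> \<in> {1..2 * n} \<rightarrow> {1..2 * n}"
    by (rule inj_on_inverseI[of _ \<sigma>], rule \<sigma>_inv) (use \<sigma>_mem in blast)+
  have signed: "g t ((\<lambda>k\<in>{1..2 * n}. z (\<sigma> k)) i) - g t ((\<lambda>k\<in>{1..2 * n}. z (\<sigma> k)) (i + n))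
      = sign_of A i * (g t (z i) - g t (z (i + n)))" if "i \<in> {1..n}" for t z i
  proof -
    have "i \<in> {1..2 * n}" "i + n \<in> {1..2 * n}" using that by auto
    then have "g t ((\<lambda>k\<in>{1..2 * n}. z (\<sigma> k)) i) - g t ((\<lambda>k\<in>{1..2 * n}. z (\<sigma> k)) (i + n))
      = g t (z (\<sigma> i)) - g t (z (\<sigma> (i + n)))"
      by (simp only: restrict_apply' if_True)
    also have "\<dots> = sign_of A i * (g t (z i) - g t (z (i + n)))"
      using that by (cases "i \<in> A") (simp_all add: \<sigma>_def sign_of_def)
    finally show ?thesis .
  qed
  have exchange: "distr (Pi\<^sub>M {1..2 * n} (\<lambda>_. Q)) (Pi\<^sub>M {1..2 * n} (\<lambda>_. Q)) (\<lambda>z. \<lambda>k\<in>{1..2 * n}. z (\<sigma> k))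
      = Pi\<^sub>M {1..2 * n} (\<lambda>_. Q)"
    by (rule distr_PiM_reindex[where M="\<lambda>_. Q" and K="{1..2 * n}"]) (rule Q, rule \<sigma>(1), rule \<sigma>(2))
  have "(\<integral>\<^sup>+ z. H z \<partial>Pi\<^sub>M {1..2 * n} (\<lambda>_. Q))
      = (\<integral>\<^sup>+ z. H z \<partial>distr (Pi\<^sub>M {1..2 * n} (\<lambda>_. Q)) (Pi\<^sub>M {1..2 * n} (\<lambda>_. Q)) (\<lambda>z. \<lambda>k\<in>{1..2 * n}. z (\<sigma> k)))"
    by (rule arg_cong[OF exchange, where f="\<lambda>P. integral\<^sup>N P H", symmetric])
  also have "\<dots> = (\<integral>\<^sup>+ z. H (\<lambda>k\<in>{1..2 * n}. z (\<sigma> k)) \<partial>Pi\<^sub>M {1..2 * n} (\<lambda>_. Q))"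
  proof (rule nn_integral_distr)
    show "(\<lambda>z. \<lambda>k\<in>{1..2 * n}. z (\<sigma> k)) \<in> Pi\<^sub>M {1..2 * n} (\<lambda>_. Q) \<rightarrow>\<^sub>M Pi\<^sub>M {1..2 * n} (\<lambda>_. Q)"
      using \<sigma>(2) by (intro measurable_restrict measurable_component_singleton) auto
  qed (subst measurable_distr_eq1, rule H_meas)
  also have "\<dots> = (\<integral>\<^sup>+ z. (SUP t\<in>T. ennreal ((\<Sum>i=1..n. sign_of A i * (g t (z i) - g t (z (i + n)))) ^ q)) \<partial>Pi\<^sub>M {1..2 * n} (\<lambda>_. Q))"
    unfolding H_def
    by (intro nn_integral_cong SUP_cong refl arg_cong[where f=ennreal] arg_cong[where f="\<lambda>x. x ^ q"] sum.cong signed)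
  finally show ?thesis by (simp add: H_def)
qed

lemma even_power_diff_le: 
  fixes a b :: real
  assumes "even q"
  shows "(a - b) ^ q \<le> 2 ^ q * (a ^ q + b ^ q)"
proof -
  have "\<bar>a - b\<bar> ^ q \<le> (2 * max \<bar>a\<bar> \<bar>b\<bar>) ^ q" by (intro power_mono) auto
  also have "\<dots> = 2 ^ q * max \<bar>a\<bar> \<bar>b\<bar> ^ q" by (rule power_mult_distrib)
  also have "max \<bar>a\<bar> \<bar>b\<bar> ^ q \<le> \<bar>a\<bar> ^ q + \<bar>b\<bar> ^ q" by (auto simp: max_def)
  finally show ?thesis using assms by (simp add: power_even_abs)
qed

text \<open>
  The moment inequality for the empirical process of the weighted tail indicators. By
  symmetrisation the centred sum is dominated by the average over all signs of the process
  \<open>sign_of A i * (g t (z i) - g t (z (i + n)))\<close>. For fixed data \<open>z\<close> this is a difference of two signed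
  tail sums with thresholds \<open>\<tau> (z i)\<close> and \<open>\<tau> (z (i + n))\<close>, to which the maximal inequality for
  deterministic weights applies; integrating the resulting sum of \<open>2 * n\<close> powers of the weights
  gives \<open>n ^ (m - 1) * (2 * n)\<close> times their moment.
\<close>

theorem weighted_tail_process_moment:
  fixes \<tau> v :: "'a \<Rightarrow> real"
  assumes Q: "prob_space Q" and [measurable]: "\<tau> \<in> borel_measurable Q"
    and v: "integrable Q v" "integrable Q (\<lambda>y. v y ^ (2 * m))"
    and m: "even m" "m > 0" and T: "countable T"
  shows "(\<integral>\<^sup>+ x. (SUP t\<in>T. ennreal ((\<Sum>i=1..n. of_bool (t \<le> \<tau> (x i)) * v (x i)
        - (\<integral>y. of_bool (t \<le> \<tau> y) * v y \<partial>Q)) ^ (2 * m))) \<partial>Pi\<^sub>M {1..n} (\<lambda>_. Q))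
    \<le> ennreal (24 * fact (2 * m) * 2 ^ (2 * m) * (\<integral>y. v y ^ (2 * m) \<partial>Q) * real n ^ m)"
proof (cases "n = 0")
  case True
  then show ?thesis using m by (simp add: SUP_constant power_0_left bot_ennreal)
next
  case False
  define g where "g t y = of_bool (t \<le> \<tau> y) * v y" for t y
  define c where "c = 12 * fact (2 * m) * 2 ^ n * real n ^ (m - 1)"
  have "c \<ge> 0" by (simp add: c_def)
  let ?P = "Pi\<^sub>M {1..2 * n} (\<lambda>_. Q)"
  have [measurable]: "v \<in> borel_measurable Q" using v by auto
  have g_int: "integrable Q (g t)" for t
    unfolding g_def by (rule Bochner_Integration.integrable_bound[OF v(1)]) auto
  have g_meas: "g t \<in> borel_measurable Q" for t
    using g_int by auto
  define H where "H A z = (SUP t\<in>T. ennreal ((\<Sum>i=1..n. sign_of A i * (g t (z i) - g t (z (i + n)))) ^ (2 * m)))" for A z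
  have H_meas: "H A \<in> borel_measurable ?P" for A
    unfolding H_def
  proof (intro borel_measurable_SUP T measurable_compose[OF _ measurable_ennreal]
      borel_measurable_power borel_measurable_sum borel_measurable_diff borel_measurable_times)
    fix t i assume "t \<in> T" "i \<in> {1..n}"
    then show "(\<lambda>z. g t (z i)) \<in> borel_measurable ?P" "(\<lambda>z. g t (z (i + n))) \<in> borel_measurable ?P"
      by (auto intro!: borel_measurable_PiM_component g_meas)
  qed auto
  have H_le: "(\<Sum>A\<in>Pow {1..n}. H A z) \<le> ennreal (2 ^ (2 * m) * c * (\<Sum>k=1..2 * n. v (z k) ^ (2 * m)))" for z
  proof -
    \<comment> \<open>\<open>L 0\<close> is the signed tail sum of the sample, \<open>L n\<close> that of the ghost sample.\<close>
    define L where "L s A t = (\<Sum>i=1..n. sign_of A i * g t (z (i + s)))" for s A t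
    have L_le: "(\<Sum>A\<in>Pow {1..n}. SUP t. ennreal (L s A t ^ (2 * m))) \<le> ennreal (c * (\<Sum>i=1..n. v (z (i + s)) ^ (2 * m)))" for s
      using signed_tail_sum_maximal_moment[of "{1..n}" m "\<lambda>i. \<tau> (z (i + s))" "\<lambda>i. v (z (i + s))"] m
      by (simp add: L_def g_def c_def)
    have "(\<Sum>A\<in>Pow {1..n}. H A z)
      \<le> (\<Sum>A\<in>Pow {1..n}. ennreal (2 ^ (2 * m)) * ((SUP t. ennreal (L 0 A t ^ (2 * m))) + (SUP t. ennreal (L n A t ^ (2 * m)))))"
      unfolding H_def
    proof (intro sum_mono SUP_least)
      fix A t
      have "(\<Sum>i=1..n. sign_of A i * (g t (z i) - g t (z (i + n)))) = L 0 A t - L n A t"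
        by (simp add: L_def right_diff_distrib sum_subtractf)
      then have "ennreal ((\<Sum>i=1..n. sign_of A i * (g t (z i) - g t (z (i + n)))) ^ (2 * m))
        \<le> ennreal (2 ^ (2 * m) * (L 0 A t ^ (2 * m) + L n A t ^ (2 * m)))"
        using even_power_diff_le[of "2 * m" "L 0 A t" "L n A t"] by (auto intro!: ennreal_leI)
      also have "\<dots> = ennreal (2 ^ (2 * m)) * (ennreal (L 0 A t ^ (2 * m)) + ennreal (L n A t ^ (2 * m)))"
        by (simp add: ennreal_mult' ennreal_plus zero_le_even_power del: power_mult)
      also have "\<dots> \<le> ennreal (2 ^ (2 * m)) * ((SUP t. ennreal (L 0 A t ^ (2 * m))) + (SUP t. ennreal (L n A t ^ (2 * m))))"
        by (intro mult_left_mono add_mono SUP_upper) auto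
      finally show "ennreal ((\<Sum>i=1..n. sign_of A i * (g t (z i) - g t (z (i + n)))) ^ (2 * m)) \<le> \<dots>" .
    qed
    also have "\<dots> = ennreal (2 ^ (2 * m)) * ((\<Sum>A\<in>Pow {1..n}. SUP t. ennreal (L 0 A t ^ (2 * m))) + (\<Sum>A\<in>Pow {1..n}. SUP t. ennreal (L n A t ^ (2 * m))))"
      by (simp only: sum_distrib_left[symmetric] sum.distrib)
    also have "\<dots> \<le> ennreal (2 ^ (2 * m)) * (ennreal (c * (\<Sum>i=1..n. v (z (i + 0)) ^ (2 * m))) + ennreal (c * (\<Sum>i=1..n. v (z (i + n)) ^ (2 * m))))"
      by (intro mult_left_mono add_mono L_le) auto
    also have "\<dots> = ennreal (2 ^ (2 * m) * (c * (\<Sum>i=1..n. v (z (i + 0)) ^ (2 * m)) + c * (\<Sum>i=1..n. v (z (i + n)) ^ (2 * m))))"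
    proof -
      have "0 \<le> c * (\<Sum>i=1..n. v (z (i + s)) ^ (2 * m))" for s
        using \<open>c \<ge> 0\<close> by (intro mult_nonneg_nonneg sum_nonneg zero_le_even_power) auto
      then show ?thesis by (simp only: ennreal_plus ennreal_mult' zero_le_power zero_le_numeral)
    qed
    also have "c * (\<Sum>i=1..n. v (z (i + 0)) ^ (2 * m)) + c * (\<Sum>i=1..n. v (z (i + n)) ^ (2 * m)) = c * (\<Sum>k=1..2 * n. v (z k) ^ (2 * m))"
    proof -
      have "(\<Sum>k=1..2 * n. v (z k) ^ (2 * m)) = (\<Sum>k=1..n. v (z k) ^ (2 * m)) + (\<Sum>k=n+1..n+n. v (z k) ^ (2 * m))"
        using sum.ub_add_nat[of 1 n "\<lambda>k. v (z k) ^ (2 * m)" n] by (simp add: mult_2)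
      also have "(\<Sum>k=n+1..n+n. v (z k) ^ (2 * m)) = (\<Sum>i=1..n. v (z (i + n)) ^ (2 * m))"
        using sum.shift_bounds_cl_nat_ivl[of "\<lambda>k. v (z k) ^ (2 * m)" 1 n n] by (simp add: add.commute)
      finally show ?thesis by (simp add: distrib_left)
    qed
    finally show ?thesis by (simp add: mult.assoc)
  qed
  \<comment> \<open>The integral of \<open>H A\<close> bounds \<open>?D\<close> for every sign pattern, so the sum over all \<open>2 ^ n\<close> patterns bounds \<open>2 ^ n * ?D\<close>.\<close>
  let ?D = "\<integral>\<^sup>+ x. (SUP t\<in>T. ennreal ((\<Sum>i=1..n. g t (x i) - (\<integral>y. g t y \<partial>Q)) ^ (2 * m))) \<partial>Pi\<^sub>M {1..n} (\<lambda>_. Q)"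
  have "ennreal (2 ^ n) * ?D = (\<Sum>A\<in>Pow {1..n}. ?D)"
    by (simp add: card_Pow ennreal_power[symmetric])
  also have "\<dots> \<le> (\<Sum>A\<in>Pow {1..n}. \<integral>\<^sup>+ z. H A z \<partial>?P)"
    unfolding H_def
  proof (rule sum_mono)
    fix A assume "A \<in> Pow {1..n}"
    then have "A \<subseteq> {1..n}" by simp
    note signs = symmetrization_random_signs[OF Q T g_meas this, where q="2 * m"]
    show "?D \<le> (\<integral>\<^sup>+ z. (SUP t\<in>T. ennreal ((\<Sum>i=1..n. sign_of A i * (g t (z i) - g t (z (i + n)))) ^ (2 * m))) \<partial>?P)"
      unfolding signs by (rule symmetrization_ghost_sample[OF Q T g_int]) simp
  qed
  also have "\<dots> = (\<integral>\<^sup>+ z. (\<Sum>A\<in>Pow {1..n}. H A z) \<partial>?P)"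
    by (rule nn_integral_sum[symmetric]) (rule H_meas)
  also have "\<dots> \<le> (\<integral>\<^sup>+ z. ennreal (2 ^ (2 * m) * c * (\<Sum>k=1..2 * n. v (z k) ^ (2 * m))) \<partial>?P)"
    by (intro nn_integral_mono H_le)
  also have "\<dots> = ennreal (\<integral>z. 2 ^ (2 * m) * c * (\<Sum>k=1..2 * n. v (z k) ^ (2 * m)) \<partial>?P)"
    using \<open>c \<ge> 0\<close>
    by (intro nn_integral_eq_integral integrable_mult_right Bochner_Integration.integrable_sum integral_PiM_component[OF Q _ v(2)])
      (auto intro!: mult_nonneg_nonneg sum_nonneg zero_le_even_power)
  also have "(\<integral>z. 2 ^ (2 * m) * c * (\<Sum>k=1..2 * n. v (z k) ^ (2 * m)) \<partial>?P)
      = 2 ^ (2 * m) * c * (\<Sum>k=1..2 * n. \<integral>y. v y ^ (2 * m) \<partial>Q)"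
    by (subst integral_mult_right_zero, subst Bochner_Integration.integral_sum)
      (auto intro!: sum.cong integral_PiM_component[OF Q _ v(2)] simp: integral_PiM_component(2)[OF Q _ v(2)])
  also have "\<dots> = 2 ^ n * (24 * fact (2 * m) * 2 ^ (2 * m) * (\<integral>y. v y ^ (2 * m) \<partial>Q) * real n ^ m)"
    using m by (cases m) (simp_all add: c_def)
  also have "ennreal \<dots> = ennreal (2 ^ n) * ennreal (24 * fact (2 * m) * 2 ^ (2 * m) * (\<integral>y. v y ^ (2 * m) \<partial>Q) * real n ^ m)"
    by (intro ennreal_mult) (auto intro!: mult_nonneg_nonneg integral_nonneg zero_le_even_power)
  finally have "ennreal (2 ^ n) * ?D \<le> ennreal (2 ^ n) * ennreal (24 * fact (2 * m) * 2 ^ (2 * m) * (\<integral>y. v y ^ (2 * m) \<partial>Q) * real n ^ m)" .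
  then show ?thesis
    unfolding g_def by (subst (asm) ennreal_mult_le_mult_iff) auto
qed

section \<open>The empirical process of the Cox model\<close>

text \<open>
  The deviation process is left continuous in \<open>t\<close>, as \<open>t \<mapsto> 1{t \<le> T}\<close> is. Hence its supremum can
  be taken over the rationals, which makes it measurable and makes the inequality for countable index sets applicable.
\<close>

lemma SUP_Rats_left_continuous:
  fixes h :: "real \<Rightarrow> real"
  assumes "\<And>t. (h \<longlongrightarrow> h t) (at_left t)"
  shows "(SUP t. ennreal (h t)) = (SUP t\<in>\<rat>. ennreal (h t))"
proof (rule antisym[OF SUP_least])
  fix t
  show "ennreal (h t) \<le> (SUP t\<in>\<rat>. ennreal (h t))" (is "_ \<le> ?S")
  proof (rule ccontr)
    assume "\<not> ennreal (h t) \<le> ?S"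
    then have "?S < ennreal (h t)" by simp
    moreover have "((\<lambda>s. ennreal (h s)) \<longlongrightarrow> ennreal (h t)) (at_left t)"
      by (intro tendsto_ennrealI assms)
    ultimately have "eventually (\<lambda>s. ?S < ennreal (h s)) (at_left t)"
      by (rule order_tendstoD(1)[rotated])
    then obtain b where b: "b < t" "\<And>s. b < s \<Longrightarrow> s < t \<Longrightarrow> ?S < ennreal (h s)"
      by (subst (asm) eventually_at_left[of "t - 1"]) auto
    obtain s where s: "s \<in> \<rat>" "b < s" "s < t"
      using Rats_dense_in_real[OF b(1)] by auto
    then have "ennreal (h s) \<le> ?S" by (intro SUP_upper)
    with b(2)[OF s(2,3)] show False by simp
  qed
qed (auto intro!: SUP_subset_mono)

lemma tendsto_at_left_survival_indicator:
  fixes x t :: real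
  shows "((\<lambda>s. of_bool (s \<le> x) :: real) \<longlongrightarrow> of_bool (t \<le> x)) (at_left t)"
proof (rule tendsto_eventually)
  show "eventually (\<lambda>s. of_bool (s \<le> x) = (of_bool (t \<le> x) :: real)) (at_left t)"
  proof (cases "t \<le> x")
    case True
    then show ?thesis
      by (subst eventually_at_left[of "t - 1"]) (auto intro!: exI[of _ "t - 1"])
  next
    case False
    then show ?thesis
      by (subst eventually_at_left[of "t - 1"]) (auto intro!: exI[of _ x])
  qed
qed

lemma tendsto_at_left_weighted_survival:
  fixes T v :: "'a \<Rightarrow> real"
  assumes [measurable]: "T \<in> borel_measurable M" and v: "integrable M v"
  shows "((\<lambda>s. \<integral>\<omega>. of_bool (s \<le> T \<omega>) * v \<omega> \<partial>M) \<longlongrightarrow> (\<integral>\<omega>. of_bool (t \<le> T \<omega>) * v \<omega> \<partial>M)) (at_left t)"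
proof (rule tendsto_at_left_sequentially[of "t - 1"])
  fix S :: "nat \<Rightarrow> real"
  assume S: "\<And>n. S n < t" "S \<longlonglongrightarrow> t"
  have [measurable]: "v \<in> borel_measurable M" using v by auto
  have "filterlim S (at_left t) sequentially"
    using S by (auto simp: filterlim_at intro!: always_eventually)
  then have lim: "(\<lambda>n. of_bool (S n \<le> x) :: real) \<longlonglongrightarrow> of_bool (t \<le> x)" for x
    by (rule filterlim_compose[OF tendsto_at_left_survival_indicator])
  show "(\<lambda>n. \<integral>\<omega>. of_bool (S n \<le> T \<omega>) * v \<omega> \<partial>M) \<longlonglongrightarrow> (\<integral>\<omega>. of_bool (t \<le> T \<omega>) * v \<omega> \<partial>M)"
  proof (rule integral_dominated_convergence[where w="\<lambda>\<omega>. \<bar>v \<omega>\<bar>"])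
    show "AE \<omega> in M. (\<lambda>n. of_bool (S n \<le> T \<omega>) * v \<omega>) \<longlonglongrightarrow> of_bool (t \<le> T \<omega>) * v \<omega>"
      by (intro AE_I2 tendsto_mult lim tendsto_const)
  qed (use v in auto)
qed auto

text \<open>
  Replaces the real exponent \<open>p\<close> by an even integer one via \<open>y powr p \<le> 1 + y ^ (2 * m)\<close> with
  \<open>y = sqrt n * \<bar>d\<bar>\<close>; the right-hand side is written in terms of the unnormalised sum \<open>n * d\<close>.
\<close>

lemma scaled_power_le:
  fixes d p :: real and n m :: nat
  assumes "n \<ge> 1" "1 \<le> p" "p \<le> 2 * real m"
  shows "real n powr (p / 2) * \<bar>d\<bar> powr p \<le> 1 + 1 / real n ^ m * (real n * d) ^ (2 * m)"
proof -
  define y where "y = sqrt (real n) * \<bar>d\<bar>"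
  have "y \<ge> 0" by (simp add: y_def)
  have "real n powr (p / 2) * \<bar>d\<bar> powr p = y powr p"
    using assms by (simp add: y_def powr_mult powr_half_sqrt[symmetric] powr_powr)
  also have "\<dots> \<le> 1 + y ^ (2 * m)"
  proof (cases "y \<le> 1")
    case True
    then have "y powr p \<le> 1 powr p" using \<open>y \<ge> 0\<close> assms by (intro powr_mono2) auto
    then show ?thesis using \<open>y \<ge> 0\<close> by (simp add: add_increasing2)
  next
    case False
    then have "y powr p \<le> y powr (real (2 * m))" using assms by (intro powr_mono) auto
    also have "\<dots> = y ^ (2 * m)" using False by (subst powr_realpow) auto
    finally show ?thesis by simp
  qed
  also have "y ^ (2 * m) = real n ^ m * d ^ (2 * m)"
    by (simp add: y_def power_mult_distrib power_mult)
  also have "\<dots> = 1 / real n ^ m * (real n * d) ^ (2 * m)"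
    using assms by (simp add: power_mult_distrib power_mult power2_eq_square)
  finally show ?thesis .
qed

theorem lemma3:
  fixes M :: "'w measure"
    and X C :: "'w \<Rightarrow> real"
    and Z :: "'w \<Rightarrow> real ^ 'd"
    and F G :: "real ^ 'd \<Rightarrow> real measure"
    and f :: "real \<Rightarrow> real ^ 'd \<Rightarrow> real"
    and lambda\<^sub>0 :: "real \<Rightarrow> real"
    and \<beta>\<^sub>0 :: "real ^ 'd"
    and Ti Di :: "nat \<Rightarrow> 'w \<Rightarrow> real"
    and Zi :: "nat \<Rightarrow> 'w \<Rightarrow> real ^ 'd"
    and p :: real
  assumes "cox_sample M X C Z F G f lambda\<^sub>0 \<beta>\<^sub>0 Ti Di Zi"
    and "\<And>q::real. q \<ge> 1 \<Longrightarrow> integrable M (\<lambda>\<omega>. exp (q * (\<beta>\<^sub>0 \<bullet> Z \<omega>)))"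
    and "p \<ge> 1"
  shows "(\<forall>n\<ge>1. scaled_sup_deviation M (follow_up_time X C) Z Ti Zi p \<beta>\<^sub>0 n \<in> borel_measurable M) \<and>
    (\<exists>K::real. K > 0 \<and>
      (SUP n\<in>{1..}. \<integral>\<^sup>+ \<omega>. scaled_sup_deviation M (follow_up_time X C) Z Ti Zi p \<beta>\<^sub>0 n \<omega> \<partial>M)
        \<le> ennreal K)"
proof -
  interpret cox_sample M X C Z F G f lambda\<^sub>0 \<beta>\<^sub>0 Ti Di Zi by (rule assms(1))
  let ?N = "borel \<Otimes>\<^sub>M borel \<Otimes>\<^sub>M borel :: (real \<times> real \<times> (real ^ 'd)) measure"
  let ?T = "follow_up_time X C"
  let ?obs = "\<lambda>i \<omega>. (Ti i \<omega>, Di i \<omega>, Zi i \<omega>)"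
  let ?proto = "\<lambda>\<omega>. (?T \<omega>, event_indicator X C \<omega>, Z \<omega>)"
  define Q where "Q = distr M ?N ?proto"
  define v where "v y = exp (\<beta>\<^sub>0 \<bullet> snd (snd y))" for y :: "real \<times> real \<times> (real ^ 'd)"
  note [measurable] = X_measurable C_measurable Z_measurable
  have T_meas[measurable]: "?T \<in> borel_measurable M"
    unfolding follow_up_time_def[abs_def] by measurable
  have [measurable]: "event_indicator X C \<in> borel_measurable M"
    unfolding event_indicator_def[abs_def] by measurable
  have Y0[measurable]: "?proto \<in> M \<rightarrow>\<^sub>M ?N"
    by measurable
  have Y[measurable]: "?obs i \<in> M \<rightarrow>\<^sub>M ?N" if "1 \<le> i" for i
    using independent that unfolding indep_vars_def by auto
  have Ti_meas: "Ti i \<in> borel_measurable M" and Zi_meas: "Zi i \<in> borel_measurable M" if "1 \<le> i" for i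
    using measurable_compose[OF Y[OF that] measurable_fst]
      measurable_compose[OF Y[OF that] measurable_compose[OF measurable_snd measurable_snd]] by simp_all
  have v_meas[measurable]: "v \<in> borel_measurable ?N"
    unfolding v_def by measurable
  have sQ[measurable_cong]: "sets Q = sets ?N" by (simp add: Q_def)
  have Q: "prob_space Q" unfolding Q_def by (rule prob_space_distr) measurable
  have exp_int: "integrable M (\<lambda>\<omega>. exp (\<beta>\<^sub>0 \<bullet> Z \<omega>))"
    using assms(2)[of 1] by simp
  have v_int: "integrable Q v"
    unfolding Q_def by (subst integrable_distr_eq) (use exp_int in \<open>simp_all add: v_def\<close>)
  have Phi_Q: "(\<integral>y. of_bool (t \<le> fst y) * v y \<partial>Q) = Phi M ?T Z t \<beta>\<^sub>0" for t
    unfolding Q_def Phi_def by (subst integral_distr) (simp_all add: v_def)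

  \<comment> \<open>The factor \<open>2\<close> makes \<open>m\<close> even, as required by the moment inequality.\<close>
  define m where "m = 2 * nat \<lceil>p\<rceil>"
  have m: "even m" "m > 0" "p \<le> 2 * real m"
    using \<open>p \<ge> 1\<close> by (auto simp: m_def) linarith
  have v_int_power: "integrable Q (\<lambda>y. v y ^ (2 * m))"
  proof -
    have "integrable M (\<lambda>\<omega>. exp (real (2 * m) * (\<beta>\<^sub>0 \<bullet> Z \<omega>)))"
      using m \<open>p \<ge> 1\<close> by (intro assms(2)) simp
    then have "integrable M (\<lambda>\<omega>. exp (\<beta>\<^sub>0 \<bullet> Z \<omega>) ^ (2 * m))"
      by (simp only: exp_of_nat_mult)
    then show ?thesis
      unfolding Q_def by (subst integrable_distr_eq) (simp_all add: v_def)
  qed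

  define d where "d n t \<omega> = Phi_emp Ti Zi n t \<beta>\<^sub>0 \<omega> - Phi M ?T Z t \<beta>\<^sub>0" for n t \<omega>
  have d_left: "((\<lambda>s. d n s \<omega>) \<longlongrightarrow> d n t \<omega>) (at_left t)" for n t \<omega>
    unfolding d_def Phi_emp_def Phi_def
    by (intro tendsto_diff tendsto_mult tendsto_const tendsto_sum tendsto_at_left_survival_indicator
        tendsto_at_left_weighted_survival T_meas exp_int)
  have sup_Rats: "scaled_sup_deviation M ?T Z Ti Zi p \<beta>\<^sub>0 n \<omega>
      = ennreal (real n powr (p / 2)) * (SUP t\<in>\<rat>. ennreal (\<bar>d n t \<omega>\<bar> powr p))" for n \<omega>
    unfolding scaled_sup_deviation_def d_def[symmetric]
    using \<open>p \<ge> 1\<close>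
    by (intro arg_cong2[of _ _ _ _ "(*)"] refl SUP_Rats_left_continuous tendsto_powr' tendsto_rabs d_left tendsto_const) auto
  have d_meas: "d n t \<in> borel_measurable M" for n t
    unfolding d_def[abs_def] Phi_emp_def
  proof (intro borel_measurable_diff borel_measurable_times borel_measurable_sum borel_measurable_const)
    fix i assume "i \<in> {1..n}"
    then have [measurable]: "Ti i \<in> borel_measurable M" "Zi i \<in> borel_measurable M"
      using Ti_meas Zi_meas by auto
    show "(\<lambda>\<omega>. of_bool (t \<le> Ti i \<omega>) :: real) \<in> borel_measurable M"
      "(\<lambda>\<omega>. exp (\<beta>\<^sub>0 \<bullet> Zi i \<omega>)) \<in> borel_measurable M"
      by measurable
  qed
  have meas: "scaled_sup_deviation M ?T Z Ti Zi p \<beta>\<^sub>0 n \<in> borel_measurable M" for n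
    unfolding sup_Rats[abs_def]
  proof (intro borel_measurable_times_ennreal borel_measurable_const borel_measurable_SUP countable_rat)
    fix t
    note [measurable] = d_meas[of n t]
    show "(\<lambda>\<omega>. ennreal (\<bar>d n t \<omega>\<bar> powr p)) \<in> borel_measurable M" by measurable
  qed

  define c where "c = 24 * fact (2 * m) * 2 ^ (2 * m) * (\<integral>y. v y ^ (2 * m) \<partial>Q)"
  have "c \<ge> 0" by (auto simp: c_def v_def intro!: mult_nonneg_nonneg integral_nonneg)
  have bound: "(\<integral>\<^sup>+ \<omega>. scaled_sup_deviation M ?T Z Ti Zi p \<beta>\<^sub>0 n \<omega> \<partial>M) \<le> ennreal (1 + c)" if "n \<ge> 1" for n
  proof -
    define W where "W x = (SUP t\<in>\<rat>. ennreal ((\<Sum>i=1..n. of_bool (t \<le> fst (x i)) * v (x i)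
        - (\<integral>y. of_bool (t \<le> fst y) * v y \<partial>Q)) ^ (2 * m)))" for x :: "nat \<Rightarrow> real \<times> real \<times> (real ^ 'd)"
    let ?S = "\<lambda>\<omega>. \<lambda>i\<in>{1..n}. ?obs i \<omega>"
    have W_meas: "W \<in> borel_measurable (Pi\<^sub>M {1..n} (\<lambda>_. ?N))"
      unfolding W_def by (intro borel_measurable_SUP countable_rat) measurable
    have law: "distr M (Pi\<^sub>M {1..n} (\<lambda>_. ?N)) ?S = Pi\<^sub>M {1..n} (\<lambda>_. Q)"
    proof -
      have "indep_vars (\<lambda>_. ?N) ?obs {1..n}"
        by (rule indep_vars_subset[OF independent]) auto
      then have "distr M (Pi\<^sub>M {1..n} (\<lambda>_. ?N)) ?S = Pi\<^sub>M {1..n} (\<lambda>i. distr M ?N (?obs i))"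
        using that Y by (subst (asm) indep_vars_iff_distr_eq_PiM') auto
      also have "\<dots> = Pi\<^sub>M {1..n} (\<lambda>_. Q)"
        unfolding Q_def by (intro PiM_cong refl identically_distributed) auto
      finally show ?thesis .
    qed
    have pointwise: "scaled_sup_deviation M ?T Z Ti Zi p \<beta>\<^sub>0 n \<omega> \<le> 1 + ennreal (1 / real n ^ m) * W (?S \<omega>)" for \<omega>
    proof -
      have "ennreal (real n powr (p / 2)) * ennreal (\<bar>d n t \<omega>\<bar> powr p) \<le> 1 + ennreal (1 / real n ^ m) * W (?S \<omega>)"
        if "t \<in> \<rat>" for t
      proof -
        have nd: "real n * d n t \<omega> = (\<Sum>i=1..n. of_bool (t \<le> fst (?S \<omega> i)) * v (?S \<omega> i)
            - (\<integral>y. of_bool (t \<le> fst y) * v y \<partial>Q))"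
          unfolding Phi_Q d_def Phi_emp_def using \<open>n \<ge> 1\<close>
          by (simp add: v_def sum_subtractf right_diff_distrib)
        have "ennreal (real n powr (p / 2)) * ennreal (\<bar>d n t \<omega>\<bar> powr p)
            = ennreal (real n powr (p / 2) * \<bar>d n t \<omega>\<bar> powr p)"
          by (simp add: ennreal_mult)
        also have "\<dots> \<le> ennreal (1 + 1 / real n ^ m * (real n * d n t \<omega>) ^ (2 * m))"
          by (intro ennreal_leI scaled_power_le \<open>n \<ge> 1\<close> \<open>p \<ge> 1\<close> m)
        also have "\<dots> = ennreal 1 + ennreal (1 / real n ^ m * (real n * d n t \<omega>) ^ (2 * m))"
          by (rule ennreal_plus) (auto intro!: mult_nonneg_nonneg zero_le_even_power simp del: times_divide_eq_left)
        also have "\<dots> = 1 + ennreal (1 / real n ^ m) * ennreal ((real n * d n t \<omega>) ^ (2 * m))"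
          by (subst ennreal_mult) (auto simp: zero_le_even_power)
        also have "ennreal ((real n * d n t \<omega>) ^ (2 * m)) \<le> W (?S \<omega>)"
          unfolding nd W_def using that by (intro SUP_upper2[of t]) auto
        finally show ?thesis by (simp add: add_mono mult_left_mono)
      qed
      then show ?thesis
        unfolding sup_Rats SUP_mult_left_ennreal by (intro SUP_least)
    qed
    have S_meas: "?S \<in> M \<rightarrow>\<^sub>M Pi\<^sub>M {1..n} (\<lambda>_. ?N)"
      by (rule measurable_restrict) (simp add: Y)
    have WS_meas: "(\<lambda>\<omega>. W (?S \<omega>)) \<in> borel_measurable M"
      by (rule measurable_compose[OF S_meas W_meas])
    have "(\<integral>\<^sup>+ \<omega>. scaled_sup_deviation M ?T Z Ti Zi p \<beta>\<^sub>0 n \<omega> \<partial>M) \<le> (\<integral>\<^sup>+ \<omega>. 1 + ennreal (1 / real n ^ m) * W (?S \<omega>) \<partial>M)"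
      by (intro nn_integral_mono pointwise)
    also have "\<dots> = 1 + ennreal (1 / real n ^ m) * (\<integral>\<^sup>+ \<omega>. W (?S \<omega>) \<partial>M)"
      using WS_meas by (simp add: nn_integral_add nn_integral_cmult emeasure_space_1)
    also have "(\<integral>\<^sup>+ \<omega>. W (?S \<omega>) \<partial>M) = (\<integral>\<^sup>+ x. W x \<partial>Pi\<^sub>M {1..n} (\<lambda>_. Q))"
      unfolding law[symmetric]
      by (rule nn_integral_distr[symmetric, OF S_meas]) (simp only: measurable_distr_eq1 W_meas)
    also have "\<dots> \<le> ennreal (c * real n ^ m)"
      unfolding W_def c_def
      by (rule weighted_tail_process_moment[OF Q _ v_int v_int_power m(1,2) countable_rat]) measurable
    also have "1 + ennreal (1 / real n ^ m) * ennreal (c * real n ^ m) = ennreal (1 + c)"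
      using \<open>c \<ge> 0\<close> \<open>n \<ge> 1\<close> by (subst ennreal_mult[symmetric]) (auto simp: ennreal_plus)
    finally show ?thesis by (simp add: add_mono mult_left_mono)
  qed
  have "(SUP n\<in>{1..}. \<integral>\<^sup>+ \<omega>. scaled_sup_deviation M ?T Z Ti Zi p \<beta>\<^sub>0 n \<omega> \<partial>M) \<le> ennreal (1 + c)"
    by (intro SUP_least bound) simp
  with meas \<open>c \<ge> 0\<close> show ?thesis
    by (intro conjI allI impI exI[of _ "1 + c"]) auto
qed

end
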